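(* Let $d\ge2$ and $\rho\in(0,1)$. For $x\in\mathbb{R}^d\setminus\{0\}$ let $$x^*=\rho^{1/2}x+(1-\rho)^{1/2}\|x\|\frac{w}{\|\tilde w\|},\qquad w,\tilde w\sim N_d(0,I_d)\ \text{independent},$$ be the MpCN proposal from $x$, and put $\xi(x)=\log(\|x^*\|^2)-\log(\|x\|^2)$. Then the law of $\xi(x)$ is symmetric about the origin and does not depend on $x\in\mathbb{R}^d\setminus\{0\}$. In particular, the MpCN kernel has the random-walk Metropolis property with respect to $\Psi(x)=\log(\|x\|^2)$.
   Context: $\|\cdot\|$ is the Euclidean norm and $N_d(0,I_d)$ the standard normal law on $\mathbb{R}^d$. A probability measure $\Gamma$ on $\mathbb{R}^k$ is symmetric about the origin if $\Gamma(A)=\Gamma(-A)$ for every Borel set $A$. MpCN kernel: let $Q(x,\cdot)$ be the law of $x^*$ above (equivalently, $x^*=\rho^{1/2}x+(1-\rho)^{1/2}r^{-1/2}w$ with $w\sim N_d(0,I_d)$ and, independently, $r$ with Gamma density proportional to $t^{d/2-1}\exp(-\|x\|^2t/2)$ on $(0,\infty)$). For a target probability $\Pi(\mathrm{d}x)=\pi(x)\mathrm{d}x$ the MpCN kernel is the Metropolis-Hastings kernel with proposal kernel $Q$ and acceptance probability $\min\{1,\pi(y)\|y\|^d/(\pi(x)\|x\|^d)\}$. Random-walk property: a transition kernel $Q$ on $(E,\mathcal{E})$ has the random-walk property with respect to $\Psi:E\to\mathbb{R}^k$ if there is a probability distribution $\Gamma$ on $\mathbb{R}^k$, symmetric about the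 origin, such that $Q(y,\Psi^{-1}A)=\Gamma(A-x)$ for all $x\in\mathbb{R}^k$, $y\in E$ with $\Psi(y)=x$, and Borel sets $A\subset\mathbb{R}^k$, where $\Psi^{-1}A=\{z\in E:\Psi(z)\in A\}$ and $A-x=\{a-x:a\in A\}$. A Metropolis-Hastings kernel has the random-walk Metropolis property with respect to $\Psi$ if its proposal kernel has the random-walk property with respect to $\Psi$. Here $E=\mathbb{R}^d\setminus\{0\}$ and $k=1$. *)

theory Defs
  imports "HOL-Probability.Probability"
begin

definition std_normal_vec :: "(real ^ 'n) measure" where
  "std_normal_vec = density lborel (\<lambda>x. ennreal (\<Prod>i\<in>UNIV. std_normal_density (x $ i)))"

definition symmetric_about_origin :: "'a::euclidean_space measure \<Rightarrow> bool" where
  "symmetric_about_origin \<Gamma> \<longleftrightarrow>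
     prob_space \<Gamma> \<and> sets \<Gamma> = sets borel \<and>
     (\<forall>A\<in>sets borel. emeasure \<Gamma> A = emeasure \<Gamma> (uminus ` A))"

text \<open>
  The state space is given as a measurable space \<open>M\<close> (only \<open>space M\<close> and \<open>sets M\<close> matter), and
  a transition kernel on it is a measurable map into the probability measures on \<open>M\<close>.
\<close>

definition random_walk_property ::
  "'a measure \<Rightarrow> ('a \<Rightarrow> 'a measure) \<Rightarrow> ('a \<Rightarrow> 'b::euclidean_space) \<Rightarrow> bool" where
  "random_walk_property M Q \<Psi> \<longleftrightarrow>
     Q \<in> M \<rightarrow>\<^sub>M prob_algebra M \<and> \<Psi> \<in> M \<rightarrow>\<^sub>M borel \<and>
     (\<exists>\<Gamma>. symmetric_about_origin \<Gamma> \<and>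
        (\<forall>x. \<forall>y\<in>space M. \<Psi> y = x \<longrightarrow>
           (\<forall>A\<in>sets borel.
              emeasure (Q y) {z \<in> space M. \<Psi> z \<in> A} = emeasure \<Gamma> ((\<lambda>a. a - x) ` A))))"

text \<open>Propose \<open>y\<close> from \<open>Q x\<close>, move there with probability \<open>\<alpha> x y\<close>, and stay at \<open>x\<close> otherwise.\<close>

definition metropolis_hastings_kernel ::
  "'a measure \<Rightarrow> ('a \<Rightarrow> 'a measure) \<Rightarrow> ('a \<Rightarrow> 'a \<Rightarrow> real) \<Rightarrow> 'a \<Rightarrow> 'a measure" where
  "metropolis_hastings_kernel M Q \<alpha> x =
     measure_of (space M) (sets M)
       (\<lambda>A. (\<integral>\<^sup>+ y. ennreal (\<alpha> x y) * indicator A y \<partial>Q x)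
          + (\<integral>\<^sup>+ y. ennreal (1 - \<alpha> x y) \<partial>Q x) * indicator A x)"

text \<open>
  A Metropolis-Hastings kernel \<open>P\<close> does not determine its proposal kernel \<open>Q\<close>, so \<open>Q\<close> is an
  explicit argument, tied to \<open>P\<close> by the first conjunct.
\<close>

definition random_walk_metropolis_property ::
  "'a measure \<Rightarrow> ('a \<Rightarrow> 'a measure) \<Rightarrow> ('a \<Rightarrow> 'a measure) \<Rightarrow> ('a \<Rightarrow> 'b::euclidean_space) \<Rightarrow> bool"
  where
  "random_walk_metropolis_property M Q P \<Psi> \<longleftrightarrow>
     (\<exists>\<alpha>. case_prod \<alpha> \<in> M \<Otimes>\<^sub>M M \<rightarrow>\<^sub>M borel \<and>
          (\<forall>x\<in>space M. \<forall>y\<in>space M. 0 \<le> \<alpha> x y \<and> \<alpha> x y \<le> 1) \<and>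
          (\<forall>x\<in>space M. P x = metropolis_hastings_kernel M Q \<alpha> x)) \<and>
     random_walk_property M Q \<Psi>"

definition punctured_space :: "(real ^ 'n) measure" where
  "punctured_space = restrict_space borel (- {0})"

definition mpcn_move :: "real \<Rightarrow> real ^ 'n \<Rightarrow> real ^ 'n \<Rightarrow> real ^ 'n \<Rightarrow> real ^ 'n" where
  "mpcn_move \<rho> x w w' =
     sqrt \<rho> *\<^sub>R x + (sqrt (1 - \<rho>) * norm x) *\<^sub>R ((1 / norm w') *\<^sub>R w)"

text \<open>
  The law of the proposal is formed on the whole space and then restricted to the complement of
  the origin, which is a null set for it whenever \<open>x \<noteq> 0\<close>.
\<close>

definition mpcn_proposal :: "real \<Rightarrow> real ^ 'n \<Rightarrow> (real ^ 'n) measure" where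
  "mpcn_proposal \<rho> x =
     restrict_space
       (distr (std_normal_vec \<Otimes>\<^sub>M std_normal_vec) borel (\<lambda>(w, w'). mpcn_move \<rho> x w w'))
       (- {0})"

text \<open>Proposals from a point of zero target density are accepted, as usual.\<close>

definition mpcn_acceptance :: "(real ^ 'n \<Rightarrow> real) \<Rightarrow> real ^ 'n \<Rightarrow> real ^ 'n \<Rightarrow> real" where
  "mpcn_acceptance \<pi> x y =
     (if \<pi> x = 0 then 1
      else min 1 (\<pi> y * norm y ^ CARD('n) / (\<pi> x * norm x ^ CARD('n))))"

definition mpcn_kernel :: "real \<Rightarrow> (real ^ 'n \<Rightarrow> real) \<Rightarrow> real ^ 'n \<Rightarrow> (real ^ 'n) measure" where
  "mpcn_kernel \<rho> \<pi> =
     metropolis_hastings_kernel punctured_space (mpcn_proposal \<rho>) (mpcn_acceptance \<pi>)"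

definition log_norm_increment_law :: "real \<Rightarrow> real ^ 'n \<Rightarrow> real measure" where
  "log_norm_increment_law \<rho> x =
     distr (std_normal_vec \<Otimes>\<^sub>M std_normal_vec) borel
       (\<lambda>(w, w'). ln ((norm (mpcn_move \<rho> x w w'))\<^sup>2) - ln ((norm x)\<^sup>2))"

definition target_density :: "(real ^ 'n \<Rightarrow> real) \<Rightarrow> bool" where
  "target_density \<pi> \<longleftrightarrow>
     \<pi> \<in> borel_measurable borel \<and> (\<forall>x. 0 \<le> \<pi> x) \<and>
     prob_space (density lborel (\<lambda>x. ennreal (\<pi> x)))"

end

theory Submission imports Defs begin

text \<open>
  Conditionally on \<open>w' = u\<close>, rotation invariance of the law of \<open>w\<close> lets one turn the direction of
  \<open>x\<close> into that of \<open>u\<close>. Hence the increment has the law of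
  \<open>ln (norm v ^ 2) - ln (norm u ^ 2)\<close> with \<open>v = sqrt \<rho> *\<^sub>R u + sqrt (1 - \<rho>) *\<^sub>R w\<close>, in which \<open>x\<close> no
  longer occurs. The Gaussian pair \<open>(u, v)\<close> is exchangeable, and swapping \<open>u\<close> and \<open>v\<close> changes the
  sign of the increment.
\<close>

section \<open>The standard normal law on vectors\<close>

lemma prod_std_normal_density:
  fixes x :: "real ^ 'n"
  shows "(\<Prod>i\<in>UNIV. std_normal_density (x $ i))
    = (1 / sqrt (2 * pi)) ^ CARD('n) * exp (- (norm x)\<^sup>2 / 2)"
proof -
  have "(norm x)\<^sup>2 = (\<Sum>i\<in>UNIV. (x $ i)\<^sup>2)"
    by (simp add: norm_vec_def L2_set_def sum_nonneg)
  then have "exp (- (norm x)\<^sup>2 / 2) = (\<Prod>i\<in>UNIV. exp (- (x $ i)\<^sup>2 / 2))"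
    by (simp add: exp_sum[symmetric] sum_divide_distrib sum_negf)
  then show ?thesis
    by (simp only: std_normal_density_def prod.distrib prod_constant)
qed

text \<open>In this form the density depends on \<open>x\<close> only through \<open>norm x\<close>;
  both rotation invariance and exchangeability are read off from it.\<close>

lemma std_normal_vec_eq:
  "(std_normal_vec :: (real ^ 'n) measure) =
     density lborel (\<lambda>x. ennreal ((1 / sqrt (2 * pi)) ^ CARD('n) * exp (- (norm x)\<^sup>2 / 2)))"
  unfolding std_normal_vec_def prod_std_normal_density ..

lemma sets_std_normal_vec [simp, measurable_cong]: "sets std_normal_vec = sets borel"
  by (simp add: std_normal_vec_def)

lemma space_std_normal_vec [simp]: "space std_normal_vec = UNIV"
  by (simp add: std_normal_vec_def)

lemma prob_space_std_normal_vec: "prob_space (std_normal_vec :: (real ^ 'n) measure)"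
proof
  have 1: "(\<integral>\<^sup>+ t. ennreal (std_normal_density t) \<partial>lborel) = 1"
    using prob_space.emeasure_space_1[OF prob_space_normal_density[of 1 0]]
    by (simp add: emeasure_density)
  have inj: "inj (\<lambda>i. axis i (1::real) :: real ^ 'n)"
    by (simp add: inj_on_def axis_eq_axis)
  \<comment> \<open>The coordinate product is reindexed over \<open>Basis\<close>, the form in which
    an integral over \<open>lborel\<close> factors into one-dimensional ones.\<close>
  have B: "Basis = range (\<lambda>i. axis i (1::real) :: real ^ 'n)"
    by (auto simp: Basis_vec_def)
  have "emeasure (std_normal_vec :: (real ^ 'n) measure) (space std_normal_vec)
      = (\<integral>\<^sup>+ x. (\<Prod>b\<in>Basis. ennreal (std_normal_density (x \<bullet> b))) \<partial>(lborel :: (real ^ 'n) measure))"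
    unfolding std_normal_vec_def
    by (simp add: emeasure_density B prod.reindex[OF inj] inner_axis prod_ennreal)
  also have "\<dots> = (\<Prod>b\<in>(Basis :: (real ^ 'n) set). \<integral>\<^sup>+ t. ennreal (std_normal_density t) \<partial>lborel)"
    by (intro nn_integral_lborel_prod) auto
  finally show "emeasure (std_normal_vec :: (real ^ 'n) measure) (space std_normal_vec) = 1"
    by (simp add: 1)
qed

section \<open>Rotation invariance and exchangeability\<close>

lemma borel_measurable_orthogonal_transformation:
  fixes U :: "'a::euclidean_space \<Rightarrow> 'a"
  assumes "orthogonal_transformation U"
  shows "U \<in> borel_measurable borel"
  using assms by (intro borel_measurable_continuous_onI)
    (meson linear_continuous_on linear_conv_bounded_linear orthogonal_transformation_linear)

lemma nn_integral_lborel_translation: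
  fixes c :: "'a::euclidean_space"
  assumes "f \<in> borel_measurable borel"
  shows "(\<integral>\<^sup>+ x. f (x + c) \<partial>lborel) = (\<integral>\<^sup>+ x. f x \<partial>lborel)"
  using assms nn_integral_distr[of "(+) c" lborel borel f]
  by (simp add: lborel_distr_plus add.commute)

text \<open>
  The usual proof of uniqueness of Haar measure, with the rotation-invariant probability density
  \<open>g\<close> as the auxiliary function. The library's results on images of Lebesgue measure under linear
  maps require the index type of the vectors to be well-ordered.
\<close>

lemma nn_integral_lborel_orthogonal_transformation:
  fixes U :: "'a::euclidean_space \<Rightarrow> 'a" and f g :: "'a \<Rightarrow> ennreal"
  assumes U: "orthogonal_transformation U"
    and f[measurable]: "f \<in> borel_measurable borel" and g[measurable]: "g \<in> borel_measurable borel"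
    and g_inv: "\<And>x. g (U x) = g x" "\<And>x. g (- x) = g x"
    and g_int: "(\<integral>\<^sup>+ x. g x \<partial>lborel) = 1"
  shows "(\<integral>\<^sup>+ x. f (U x) \<partial>lborel) = (\<integral>\<^sup>+ x. f x \<partial>lborel)"
proof -
  note [measurable] = borel_measurable_orthogonal_transformation[OF U]
  have lin: "linear U"
    using U by (rule orthogonal_transformation_linear)
  \<comment> \<open>By translation invariance the inserted factor \<open>g (y - U x)\<close>
    integrates to 1 in \<open>y\<close>.\<close>
  have "(\<integral>\<^sup>+ x. f (U x) \<partial>lborel) = (\<integral>\<^sup>+ x. \<integral>\<^sup>+ y. f (U x) * g (y - U x) \<partial>lborel \<partial>lborel)"
    using nn_integral_lborel_translation[OF g, of "- U x" for x]
    by (simp add: nn_integral_cmult g_int)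
  also have "\<dots> = (\<integral>\<^sup>+ y. \<integral>\<^sup>+ x. f (U x) * g (y - U x) \<partial>lborel \<partial>lborel)"
    by (rule lborel_pair.Fubini'[symmetric]) measurable
  also have "\<dots> = (\<integral>\<^sup>+ y. \<integral>\<^sup>+ x. f (U x + y) * g x \<partial>lborel \<partial>lborel)"
  proof (rule nn_integral_cong)
    fix y :: 'a
    obtain v where v: "y = U v"
      using orthogonal_transformation_surj[OF U] by blast
    \<comment> \<open>Shifting \<open>x\<close> by a preimage \<open>v\<close> of \<open>y\<close>
      turns \<open>y - U x\<close> into \<open>- U x\<close>, and the two invariances of
      \<open>g\<close> reduce \<open>g (- U x)\<close> to \<open>g x\<close>.\<close>
    have "(\<integral>\<^sup>+ x. f (U x) * g (y - U x) \<partial>lborel)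
        = (\<integral>\<^sup>+ x. f (U (x + v)) * g (y - U (x + v)) \<partial>lborel)"
      by (rule nn_integral_lborel_translation[symmetric]) measurable
    then show "(\<integral>\<^sup>+ x. f (U x) * g (y - U x) \<partial>lborel) = (\<integral>\<^sup>+ x. f (U x + y) * g x \<partial>lborel)"
      by (simp add: linear_add[OF lin] v g_inv)
  qed
  also have "\<dots> = (\<integral>\<^sup>+ x. \<integral>\<^sup>+ y. f (U x + y) * g x \<partial>lborel \<partial>lborel)"
    by (rule lborel_pair.Fubini') measurable
  \<comment> \<open>For fixed \<open>x\<close>, translating \<open>y\<close> by \<open>U x\<close>
    removes \<open>U\<close> from the inner integral; the remaining \<open>g x\<close> has integral
    1.\<close>
  also have "\<dots> = (\<integral>\<^sup>+ x. f x \<partial>lborel)"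
    using nn_integral_lborel_translation[OF f, of "U x" for x]
    by (simp add: nn_integral_multc nn_integral_cmult g_int add.commute)
  finally show ?thesis .
qed

text \<open>An orthogonal map preserves the norm, hence the density, and it preserves Lebesgue
  measure. The density \<open>g\<close> itself serves as the auxiliary function in the preceding
  lemma.\<close>

lemma distr_std_normal_vec_orthogonal_transformation:
  fixes U :: "real ^ 'n \<Rightarrow> real ^ 'n"
  assumes U: "orthogonal_transformation U"
  shows "distr std_normal_vec borel U = std_normal_vec"
proof -
  define g :: "real ^ 'n \<Rightarrow> ennreal"
    where "g x = ennreal ((1 / sqrt (2 * pi)) ^ CARD('n) * exp (- (norm x)\<^sup>2 / 2))" for x
  note [measurable] = borel_measurable_orthogonal_transformation[OF U]
  have g_meas[measurable]: "g \<in> borel_measurable borel"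
    unfolding g_def by measurable
  have N: "std_normal_vec = density lborel g"
    unfolding std_normal_vec_eq g_def ..
  have g_inv: "g (U x) = g x" "g (- x) = g x" for x
    by (simp_all add: g_def orthogonal_transformation_norm[OF U])
  have g_int: "(\<integral>\<^sup>+ x. g x \<partial>lborel) = 1"
    using prob_space.emeasure_space_1[OF prob_space_std_normal_vec[where 'n = 'n]]
    by (simp add: N emeasure_density)
  show ?thesis
  proof (rule measure_eqI)
    fix A assume "A \<in> sets (distr std_normal_vec borel U)"
    then have [measurable]: "A \<in> sets borel" by simp
    have "emeasure (distr std_normal_vec borel U) A = (\<integral>\<^sup>+ x. g (U x) * indicator A (U x) \<partial>lborel)"
      unfolding N by (simp add: nn_integral_indicator[symmetric] nn_integral_distr nn_integral_density
          g_inv del: nn_integral_indicator)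
    also have "\<dots> = emeasure std_normal_vec A"
      unfolding N using nn_integral_lborel_orthogonal_transformation[OF U _ g_meas g_inv g_int,
          of "\<lambda>x. g x * indicator A x"]
      by (simp add: emeasure_density)
    finally show "emeasure (distr std_normal_vec borel U) A = emeasure std_normal_vec A" .
  qed simp
qed

text \<open>For \<open>b \<noteq> 0\<close> the pair \<open>(u, a u + b w)\<close> has a density that is symmetric in its two arguments.\<close>

lemma std_normal_vec_exchangeable:
  fixes f :: "real ^ 'n \<Rightarrow> real ^ 'n \<Rightarrow> ennreal"
  assumes ab: "a\<^sup>2 + b\<^sup>2 = 1" and b: "b \<noteq> 0"
    and f[measurable]: "case_prod f \<in> borel_measurable (borel \<Otimes>\<^sub>M borel)"
  shows "(\<integral>\<^sup>+ u. \<integral>\<^sup>+ w. f u (a *\<^sub>R u + b *\<^sub>R w) \<partial>std_normal_vec \<partial>std_normal_vec)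
       = (\<integral>\<^sup>+ u. \<integral>\<^sup>+ w. f (a *\<^sub>R u + b *\<^sub>R w) u \<partial>std_normal_vec \<partial>std_normal_vec)"
proof -
  define C where "C = (1 / sqrt (2 * pi)) ^ CARD('n)"
  define h where "h x = ennreal (C * exp (- (norm x)\<^sup>2 / 2))" for x :: "real ^ 'n"
  \<comment> \<open>The joint density of \<open>u\<close> and
    \<open>v = a *\<^sub>R u + b *\<^sub>R w\<close>: solving for \<open>w\<close> gives
    \<open>(1 / b) *\<^sub>R (v - a *\<^sub>R u)\<close>, with Jacobian factor
    \<open>\<bar>1 / b\<bar> ^ CARD('n)\<close>.\<close>
  define G where "G u v = ennreal (\<bar>1 / b\<bar> ^ CARD('n)) * (h u * h ((1 / b) *\<^sub>R (v - a *\<^sub>R u)))"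
    for u v :: "real ^ 'n"
  have C0: "0 \<le> C"
    unfolding C_def by simp
  have [measurable]: "h \<in> borel_measurable borel"
    unfolding h_def by measurable
  have [measurable]: "case_prod G \<in> borel_measurable (borel \<Otimes>\<^sub>M borel)"
    unfolding G_def by measurable
  have N: "std_normal_vec = density lborel h"
    unfolding std_normal_vec_eq h_def C_def ..
  have G_sym: "G u v = G v u" for u v
  proof -
    \<comment> \<open>The coefficient of \<open>(norm u)\<^sup>2\<close> is
      \<open>1 + a\<^sup>2 / b\<^sup>2\<close>, which equals \<open>1 / b\<^sup>2\<close> because
      \<open>a\<^sup>2 + b\<^sup>2 = 1\<close>. This makes the exponent symmetric in
      \<open>u\<close> and \<open>v\<close>.\<close>
    have q: "(norm u)\<^sup>2 + (norm ((1 / b) *\<^sub>R (v - a *\<^sub>R u)))\<^sup>2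
        = ((norm u)\<^sup>2 + (norm v)\<^sup>2 - 2 * a * (u \<bullet> v)) / b\<^sup>2" for u v :: "real ^ 'n"
    proof -
      have "(norm (v - a *\<^sub>R u))\<^sup>2 = (norm v)\<^sup>2 - 2 * a * (u \<bullet> v) + a\<^sup>2 * (norm u)\<^sup>2"
        unfolding power2_norm_eq_inner
        by (simp add: inner_diff_left inner_diff_right inner_commute algebra_simps power2_eq_square)
      moreover have "a\<^sup>2 = 1 - b\<^sup>2" using ab by simp
      moreover have "(norm ((1 / b) *\<^sub>R (v - a *\<^sub>R u)))\<^sup>2 = (norm (v - a *\<^sub>R u))\<^sup>2 / b\<^sup>2"
        by (simp only: norm_scaleR power_mult_distrib power_divide) (simp add: power_divide)
      ultimately show ?thesis
        using b by (simp only:) (simp add: field_simps)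
    qed
    have "h x * h y = ennreal (C\<^sup>2 * exp (- ((norm x)\<^sup>2 + (norm y)\<^sup>2) / 2))" for x y
    proof -
      have "h x * h y = ennreal (C * exp (- (norm x)\<^sup>2 / 2) * (C * exp (- (norm y)\<^sup>2 / 2)))"
        unfolding h_def using C0 by (intro ennreal_mult[symmetric]) auto
      also have "C * exp (- (norm x)\<^sup>2 / 2) * (C * exp (- (norm y)\<^sup>2 / 2))
          = C\<^sup>2 * exp (- (norm x)\<^sup>2 / 2 + - (norm y)\<^sup>2 / 2)"
        by (simp only: exp_add power2_eq_square mult_ac)
      finally show ?thesis
        by (simp add: add_divide_distrib)
    qed
    then show ?thesis
      unfolding G_def by (simp only: q inner_commute[of v u] add.commute[of "(norm v)\<^sup>2"])
  qed
  \<comment> \<open>Change of variables from \<open>w\<close> to \<open>v\<close> for fixed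
    \<open>u\<close>. The integrand \<open>k\<close> is arbitrary since the formula is applied both
    to \<open>f\<close> and to \<open>f\<close> with its arguments swapped.\<close>
  have subst: "(\<integral>\<^sup>+ u. \<integral>\<^sup>+ w. k u (a *\<^sub>R u + b *\<^sub>R w) \<partial>std_normal_vec \<partial>std_normal_vec)
      = (\<integral>\<^sup>+ u. \<integral>\<^sup>+ v. G u v * k u v \<partial>lborel \<partial>lborel)"
    if [measurable]: "case_prod k \<in> borel_measurable (borel \<Otimes>\<^sub>M borel)"
    for k :: "real ^ 'n \<Rightarrow> real ^ 'n \<Rightarrow> ennreal"
  proof -
    have inner: "h u * (\<integral>\<^sup>+ w. h w * k u (a *\<^sub>R u + b *\<^sub>R w) \<partial>lborel)
        = (\<integral>\<^sup>+ v. G u v * k u v \<partial>lborel)" for u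
    proof -
      have "(\<integral>\<^sup>+ w. h w * k u (a *\<^sub>R u + b *\<^sub>R w) \<partial>lborel)
          = (\<integral>\<^sup>+ w. h w * k u (a *\<^sub>R u + b *\<^sub>R w) \<partial>density (distr lborel borel
               (\<lambda>v. (- (a / b)) *\<^sub>R u + (1 / b) *\<^sub>R v)) (\<lambda>_. ennreal (\<bar>1 / b\<bar> ^ CARD('n))))"
        using b lborel_affine[of "1 / b" "(- (a / b)) *\<^sub>R u"] by simp
      also have "\<dots> = (\<integral>\<^sup>+ v. ennreal (\<bar>1 / b\<bar> ^ CARD('n)) *
            (h ((1 / b) *\<^sub>R (v - a *\<^sub>R u)) * k u v) \<partial>lborel)"
        using b by (simp add: nn_integral_density nn_integral_distr algebra_simps)
      finally show ?thesis
        by (simp add: G_def nn_integral_cmult[symmetric] mult_ac)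
    qed
    show ?thesis
      unfolding N by (simp add: nn_integral_density inner)
  qed
  have "(\<integral>\<^sup>+ u. \<integral>\<^sup>+ w. f u (a *\<^sub>R u + b *\<^sub>R w) \<partial>std_normal_vec \<partial>std_normal_vec)
      = (\<integral>\<^sup>+ u. \<integral>\<^sup>+ v. G u v * f u v \<partial>lborel \<partial>lborel)"
    by (rule subst) fact
  also have "\<dots> = (\<integral>\<^sup>+ v. \<integral>\<^sup>+ u. G u v * f u v \<partial>lborel \<partial>lborel)"
    by (rule lborel_pair.Fubini'[symmetric]) measurable
  also have "\<dots> = (\<integral>\<^sup>+ u. \<integral>\<^sup>+ w. f (a *\<^sub>R u + b *\<^sub>R w) u \<partial>std_normal_vec \<partial>std_normal_vec)"
    by (subst subst) (auto simp: G_sym)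
  finally show ?thesis .
qed

section \<open>Null events\<close>

lemma AE_std_normal_vec_neq: "AE w in std_normal_vec. w \<noteq> (c :: real ^ 'n)"
  unfolding std_normal_vec_def
  by (subst AE_density) (use AE_lborel_singleton[of c] in auto)

text \<open>The excluded event is the single point \<open>w = - (1 / b) *\<^sub>R v\<close>, a null
  set for a law with a Lebesgue density.\<close>

lemma AE_std_normal_vec_affine_neq_0:
  assumes "b \<noteq> 0"
  shows "AE w in std_normal_vec. v + b *\<^sub>R w \<noteq> (0 :: real ^ 'n)"
  using AE_std_normal_vec_neq[of "- (1 / b) *\<^sub>R v"]
proof eventually_elim
  case (elim w)
  then show ?case
  proof (rule contrapos_nn)
    assume "v + b *\<^sub>R w = 0"
    then have "b *\<^sub>R w = - v"
      by (metis add_eq_0_iff)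
    then have "(1 / b) *\<^sub>R (b *\<^sub>R w) = (1 / b) *\<^sub>R - v"
      by simp
    then show "w = - (1 / b) *\<^sub>R v"
      using assms by simp
  qed
qed

interpretation std_normal_vec: prob_space "std_normal_vec :: (real ^ 'n) measure"
  by (rule prob_space_std_normal_vec)

interpretation std_normal_vec_pair:
  pair_prob_space "std_normal_vec :: (real ^ 'n) measure" "std_normal_vec :: (real ^ 'n) measure" ..

section \<open>The law of the log-norm increment\<close>

lemma borel_measurable_mpcn_move [measurable (raw)]:
  assumes [measurable]: "f \<in> borel_measurable M" "g \<in> borel_measurable M" "h \<in> borel_measurable M"
  shows "(\<lambda>z. mpcn_move \<rho> (f z) (g z) (h z)) \<in> borel_measurable M"
  unfolding mpcn_move_def by measurable

text \<open>With \<open>c = norm x / norm u\<close>, some orthogonal \<open>U\<close> takes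
  \<open>u\<close> to \<open>(1 / c) *\<^sub>R x\<close>. Replacing \<open>w\<close> by
  \<open>U w\<close> keeps its law and turns the move into \<open>c\<close> times the
  \<open>U\<close>-image of \<open>sqrt \<rho> *\<^sub>R u + sqrt (1 - \<rho>) *\<^sub>R w\<close>.
  As also \<open>norm x = c * norm u\<close>, the factor \<open>c\<close> cancels in the difference
  of logarithms.\<close>

lemma nn_integral_mpcn_move_given:
  fixes x u :: "real ^ 'n" and f :: "real \<Rightarrow> ennreal"
  assumes "\<rho> < 1" "x \<noteq> 0" "u \<noteq> 0" and [measurable]: "f \<in> borel_measurable borel"
  shows "(\<integral>\<^sup>+ w. f (ln ((norm (mpcn_move \<rho> x w u))\<^sup>2) - ln ((norm x)\<^sup>2)) \<partial>std_normal_vec)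
       = (\<integral>\<^sup>+ w. f (ln ((norm (sqrt \<rho> *\<^sub>R u + sqrt (1 - \<rho>) *\<^sub>R w))\<^sup>2) - ln ((norm u)\<^sup>2))
            \<partial>std_normal_vec)"
proof -
  define c where "c = norm x / norm u"
  have c: "c > 0" and cu: "c * norm u = norm x"
    using assms by (auto simp: c_def)
  have "norm u = norm ((1 / c) *\<^sub>R x)"
    using c cu by (simp add: field_simps)
  then obtain U where U: "orthogonal_transformation U" and Uu: "U u = (1 / c) *\<^sub>R x"
    using orthogonal_transformation_exists by blast
  note [measurable] = borel_measurable_orthogonal_transformation[OF U]
  have lin: "linear U"
    using U by (rule orthogonal_transformation_linear)
  have move: "norm (mpcn_move \<rho> x (U w) u) = c * norm (sqrt \<rho> *\<^sub>R u + sqrt (1 - \<rho>) *\<^sub>R w)" for w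
  proof -
    have "mpcn_move \<rho> x (U w) u = sqrt \<rho> *\<^sub>R x + (sqrt (1 - \<rho>) * c) *\<^sub>R U w"
      by (simp add: mpcn_move_def c_def)
    moreover have "x = c *\<^sub>R U u"
      using c by (simp add: Uu)
    then have "sqrt \<rho> *\<^sub>R x = c *\<^sub>R (sqrt \<rho> *\<^sub>R U u)"
      by simp
    ultimately have "mpcn_move \<rho> x (U w) u = c *\<^sub>R U (sqrt \<rho> *\<^sub>R u + sqrt (1 - \<rho>) *\<^sub>R w)"
      by (simp add: linear_add[OF lin] linear_scale[OF lin] scaleR_add_right mult.commute)
    then show ?thesis
      using c by (simp add: orthogonal_transformation_norm[OF U])
  qed
  have "(\<integral>\<^sup>+ w. f (ln ((norm (mpcn_move \<rho> x w u))\<^sup>2) - ln ((norm x)\<^sup>2)) \<partial>std_normal_vec)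
      = (\<integral>\<^sup>+ w. f (ln ((norm (mpcn_move \<rho> x w u))\<^sup>2) - ln ((norm x)\<^sup>2)) \<partial>distr std_normal_vec borel U)"
    by (simp add: distr_std_normal_vec_orthogonal_transformation[OF U])
  also have "\<dots> = (\<integral>\<^sup>+ w. f (ln ((norm (mpcn_move \<rho> x (U w) u))\<^sup>2) - ln ((norm x)\<^sup>2)) \<partial>std_normal_vec)"
    by (rule nn_integral_distr) measurable
  also have "\<dots> = (\<integral>\<^sup>+ w. f (ln ((norm (sqrt \<rho> *\<^sub>R u + sqrt (1 - \<rho>) *\<^sub>R w))\<^sup>2) - ln ((norm u)\<^sup>2))
            \<partial>std_normal_vec)"
  proof (rule nn_integral_cong_AE)
    \<comment> \<open>The cancellation of \<open>c\<close> splits logarithms of products and so is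
      made where the vector is nonzero; at the origin \<open>ln\<close> only has a default
      value.\<close>
    have "sqrt (1 - \<rho>) \<noteq> 0"
      using assms by simp
    then have "AE w in std_normal_vec. sqrt \<rho> *\<^sub>R u + sqrt (1 - \<rho>) *\<^sub>R w \<noteq> 0"
      by (rule AE_std_normal_vec_affine_neq_0)
    then show "AE w in std_normal_vec. f (ln ((norm (mpcn_move \<rho> x (U w) u))\<^sup>2) - ln ((norm x)\<^sup>2))
        = f (ln ((norm (sqrt \<rho> *\<^sub>R u + sqrt (1 - \<rho>) *\<^sub>R w))\<^sup>2) - ln ((norm u)\<^sup>2))"
    proof eventually_elim
      case (elim w)
      define n where "n = norm (sqrt \<rho> *\<^sub>R u + sqrt (1 - \<rho>) *\<^sub>R w)"
      have "0 < n" "0 < norm u"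
        using elim assms by (auto simp: n_def)
      then show ?case
        using c unfolding move cu[symmetric] n_def[symmetric]
        by (simp add: power_mult_distrib ln_mult)
    qed
  qed
  finally show ?thesis .
qed

text \<open>Integrating the conditional identity over \<open>u\<close> gives an expression free of
  \<open>x\<close>. Applied to indicators, it yields both the independence of \<open>x\<close> and
  the symmetry.\<close>

lemma nn_integral_log_norm_increment_law:
  fixes x :: "real ^ 'n" and f :: "real \<Rightarrow> ennreal"
  assumes "\<rho> < 1" "x \<noteq> 0" and [measurable]: "f \<in> borel_measurable borel"
  shows "(\<integral>\<^sup>+ t. f t \<partial>log_norm_increment_law \<rho> x)
       = (\<integral>\<^sup>+ u. \<integral>\<^sup>+ w. f (ln ((norm (sqrt \<rho> *\<^sub>R u + sqrt (1 - \<rho>) *\<^sub>R w))\<^sup>2) - ln ((norm u)\<^sup>2))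
            \<partial>std_normal_vec \<partial>(std_normal_vec :: (real ^ 'n) measure))"
proof -
  have "(\<integral>\<^sup>+ t. f t \<partial>log_norm_increment_law \<rho> x)
      = (\<integral>\<^sup>+ z. f (ln ((norm (mpcn_move \<rho> x (fst z) (snd z)))\<^sup>2) - ln ((norm x)\<^sup>2))
          \<partial>(std_normal_vec \<Otimes>\<^sub>M std_normal_vec))"
    unfolding log_norm_increment_law_def
    by (subst nn_integral_distr) (auto simp: case_prod_beta)
  also have "\<dots> = (\<integral>\<^sup>+ u. \<integral>\<^sup>+ w. f (ln ((norm (mpcn_move \<rho> x w u))\<^sup>2) - ln ((norm x)\<^sup>2))
            \<partial>std_normal_vec \<partial>std_normal_vec)"
    \<comment> \<open>The outer integral runs over the second component, the vector on which one
      conditions.\<close>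
    by (subst std_normal_vec_pair.nn_integral_snd[symmetric]) auto
  also have "\<dots> = (\<integral>\<^sup>+ u. \<integral>\<^sup>+ w. f (ln ((norm (sqrt \<rho> *\<^sub>R u + sqrt (1 - \<rho>) *\<^sub>R w))\<^sup>2) - ln ((norm u)\<^sup>2))
            \<partial>std_normal_vec \<partial>(std_normal_vec :: (real ^ 'n) measure))"
  proof (rule nn_integral_cong_AE)
    show "AE u in std_normal_vec.
        (\<integral>\<^sup>+ w. f (ln ((norm (mpcn_move \<rho> x w u))\<^sup>2) - ln ((norm x)\<^sup>2)) \<partial>std_normal_vec)
      = (\<integral>\<^sup>+ w. f (ln ((norm (sqrt \<rho> *\<^sub>R u + sqrt (1 - \<rho>) *\<^sub>R w))\<^sup>2) - ln ((norm u)\<^sup>2))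
            \<partial>(std_normal_vec :: (real ^ 'n) measure))"
      \<comment> \<open>The null event \<open>u = 0\<close> is discarded: there
        \<open>1 / norm u\<close> is \<open>0\<close> by convention and no rotation argument
        applies.\<close>
      using AE_std_normal_vec_neq[of 0] 
    proof eventually_elim
      case (elim u)
      then show ?case
        using assms by (intro nn_integral_mpcn_move_given)
    qed
  qed
  finally show ?thesis .
qed

lemma sets_log_norm_increment_law [simp, measurable_cong]:
  "sets (log_norm_increment_law \<rho> x) = sets borel"
  by (simp add: log_norm_increment_law_def)

lemma log_norm_increment_law_unique:
  fixes x y :: "real ^ 'n"
  assumes "\<rho> < 1" "x \<noteq> 0" "y \<noteq> 0"
  shows "log_norm_increment_law \<rho> x = log_norm_increment_law \<rho> y"
proof (rule measure_eqI)
  fix A assume "A \<in> sets (log_norm_increment_law \<rho> x)"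
  then show "emeasure (log_norm_increment_law \<rho> x) A = emeasure (log_norm_increment_law \<rho> y) A"
    using nn_integral_log_norm_increment_law[of \<rho> x "indicator A"]
      nn_integral_log_norm_increment_law[of \<rho> y "indicator A"] assms
    by simp
qed simp

lemma symmetric_log_norm_increment_law:
  fixes x :: "real ^ 'n"
  assumes "0 \<le> \<rho>" "\<rho> < 1" "x \<noteq> 0"
  shows "symmetric_about_origin (log_norm_increment_law \<rho> x)"
  unfolding symmetric_about_origin_def
proof (intro conjI ballI)
  show "prob_space (log_norm_increment_law \<rho> x)"
    unfolding log_norm_increment_law_def
    by (rule std_normal_vec_pair.prob_space_distr) measurable
next
  fix A :: "real set" assume [measurable]: "A \<in> sets borel"
  \<comment> \<open>Negation is an involution, so the image is a preimage. This gives measurability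
    and moves the sign from the set to the argument of its indicator.\<close>
  have um: "uminus ` A = uminus -` A"
    by (force simp: image_iff)
  have [measurable]: "uminus ` A \<in> sets borel"
    unfolding um using measurable_sets_borel[of uminus borel A] by simp
  let ?v = "\<lambda>u w :: real ^ 'n. sqrt \<rho> *\<^sub>R u + sqrt (1 - \<rho>) *\<^sub>R w"
  have "emeasure (log_norm_increment_law \<rho> x) A
     = (\<integral>\<^sup>+ u. \<integral>\<^sup>+ w. indicator A (ln ((norm (?v u w))\<^sup>2) - ln ((norm u)\<^sup>2))
          \<partial>std_normal_vec \<partial>std_normal_vec)"
    using nn_integral_log_norm_increment_law[of \<rho> x "indicator A"] assms by simp
  also have "\<dots> = (\<integral>\<^sup>+ u. \<integral>\<^sup>+ w. indicator A (ln ((norm u)\<^sup>2) - ln ((norm (?v u w))\<^sup>2))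
          \<partial>std_normal_vec \<partial>std_normal_vec)"
    using assms
    by (intro std_normal_vec_exchangeable[where f = "\<lambda>u v. indicator A (ln ((norm v)\<^sup>2) - ln ((norm u)\<^sup>2))"])
      auto
  also have "\<dots> = (\<integral>\<^sup>+ u. \<integral>\<^sup>+ w. indicator (uminus ` A) (ln ((norm (?v u w))\<^sup>2) - ln ((norm u)\<^sup>2))
          \<partial>std_normal_vec \<partial>std_normal_vec)"
    unfolding um by (simp add: indicator_def)
  also have "\<dots> = emeasure (log_norm_increment_law \<rho> x) (uminus ` A)"
    using nn_integral_log_norm_increment_law[of \<rho> x "indicator (uminus ` A)"] assms by simp
  finally show "emeasure (log_norm_increment_law \<rho> x) A
    = emeasure (log_norm_increment_law \<rho> x) (uminus ` A)" .
qed simp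

section \<open>The proposal kernel on the punctured space\<close>

lemma space_punctured_space [simp]: "space punctured_space = - {0}"
  by (simp add: punctured_space_def space_restrict_space)

lemma sets_punctured_space_iff: "A \<in> sets punctured_space \<longleftrightarrow> 0 \<notin> A \<and> A \<in> sets borel"
  by (auto simp: punctured_space_def sets_restrict_space_iff)

lemma measurable_ident_punctured_space: "(\<lambda>x. x) \<in> borel_measurable punctured_space"
  unfolding punctured_space_def by (rule measurable_restrict_space1) simp

lemma sets_mpcn_proposal: "sets (mpcn_proposal \<rho> x) = sets punctured_space"
  unfolding mpcn_proposal_def punctured_space_def by (rule sets_restrict_space_cong) simp

text \<open>A measurable subset of the punctured space is a Borel set that misses the origin, so the
  restriction leaves its mass unchanged.\<close>

lemma emeasure_mpcn_proposal:
  assumes "A \<in> sets punctured_space"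
  shows "emeasure (mpcn_proposal \<rho> x) A
    = emeasure (std_normal_vec \<Otimes>\<^sub>M std_normal_vec) {z. mpcn_move \<rho> x (fst z) (snd z) \<in> A}"
  using assms
  by (auto simp: mpcn_proposal_def sets_punctured_space_iff emeasure_restrict_space emeasure_distr
      space_pair_measure vimage_def case_prod_beta)

text \<open>For fixed nonzero \<open>u\<close> the move is affine in \<open>w\<close> with a nonzero
  coefficient, so it vanishes for at most one \<open>w\<close>.\<close>

lemma AE_mpcn_move_neq_0:
  fixes x :: "real ^ 'n"
  assumes "0 < \<rho>" "\<rho> < 1" "x \<noteq> 0"
  shows "AE z in std_normal_vec \<Otimes>\<^sub>M std_normal_vec. mpcn_move \<rho> x (fst z) (snd z) \<noteq> 0"
proof -
  have "AE w in std_normal_vec. mpcn_move \<rho> x w u \<noteq> 0" for u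
  proof (cases "u = 0")
    case True
    \<comment> \<open>Here \<open>1 / norm u\<close> is \<open>0\<close>, and the move is the
      nonzero vector \<open>sqrt \<rho> *\<^sub>R x\<close>.\<close>
    then show ?thesis using assms by (simp add: mpcn_move_def)
  next
    case False
    then show ?thesis
      using assms AE_std_normal_vec_affine_neq_0[of "sqrt (1 - \<rho>) * norm x / norm u" "sqrt \<rho> *\<^sub>R x"]
      by (simp add: mpcn_move_def)
  qed
  then have "AE u in std_normal_vec. AE w in std_normal_vec. mpcn_move \<rho> x w u \<noteq> 0"
    by simp
  moreover have meas: "{z \<in> space (std_normal_vec \<Otimes>\<^sub>M std_normal_vec).
      mpcn_move \<rho> x (fst z) (snd z) \<noteq> 0} \<in> sets (std_normal_vec \<Otimes>\<^sub>M std_normal_vec)"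
    by measurable
  \<comment> \<open>The quantifiers are exchanged because the product criterion has the first
    component \<open>w\<close> outermost.\<close>
  ultimately have "AE w in std_normal_vec. AE u in std_normal_vec. mpcn_move \<rho> x w u \<noteq> 0"
    by (simp only: std_normal_vec_pair.AE_commute)
  with meas show ?thesis
    by (intro std_normal_vec_pair.AE_pair_measure) simp_all
qed

text \<open>The log-norm of the proposal lies in \<open>A\<close> exactly when the increment lies in
  \<open>A\<close> shifted by \<open>- ln ((norm y)\<^sup>2)\<close>. Removing the origin changes
  the event by a null set only.\<close>

lemma emeasure_mpcn_proposal_log_norm:
  fixes y :: "real ^ 'n"
  assumes "0 < \<rho>" "\<rho> < 1" "y \<noteq> 0" and [measurable]: "A \<in> sets borel"
  shows "emeasure (mpcn_proposal \<rho> y) {z \<in> - {0}. ln ((norm z)\<^sup>2) \<in> A}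
    = emeasure (log_norm_increment_law \<rho> y) ((\<lambda>a. a - ln ((norm y)\<^sup>2)) ` A)"
proof -
  let ?x = "ln ((norm y)\<^sup>2)"
  have im: "(\<lambda>a. a - ?x) ` A = (\<lambda>t. t + ?x) -` A"
    by (force simp: image_iff)
  have [measurable]: "(\<lambda>t. t + ?x) -` A \<in> sets borel"
    using measurable_sets_borel[of "\<lambda>t. t + ?x" borel A] by simp
  have "{z \<in> - {0}. ln ((norm z)\<^sup>2) \<in> A} \<in> sets (punctured_space :: (real ^ 'n) measure)"
    by (auto simp: sets_punctured_space_iff)
  then have "emeasure (mpcn_proposal \<rho> y) {z \<in> - {0}. ln ((norm z)\<^sup>2) \<in> A}
    = emeasure (std_normal_vec \<Otimes>\<^sub>M std_normal_vec)
        {z. mpcn_move \<rho> y (fst z) (snd z) \<noteq> 0 \<and> ln ((norm (mpcn_move \<rho> y (fst z) (snd z)))\<^sup>2) \<in> A}"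
    by (simp add: emeasure_mpcn_proposal)
  also have "\<dots> = emeasure (std_normal_vec \<Otimes>\<^sub>M std_normal_vec)
        {z. ln ((norm (mpcn_move \<rho> y (fst z) (snd z)))\<^sup>2) \<in> A}"
  proof (rule emeasure_eq_AE)
    show "AE z in std_normal_vec \<Otimes>\<^sub>M std_normal_vec.
        z \<in> {z. mpcn_move \<rho> y (fst z) (snd z) \<noteq> 0 \<and> ln ((norm (mpcn_move \<rho> y (fst z) (snd z)))\<^sup>2) \<in> A}
        \<longleftrightarrow> z \<in> {z. ln ((norm (mpcn_move \<rho> y (fst z) (snd z)))\<^sup>2) \<in> A}"
      using AE_mpcn_move_neq_0[OF assms(1-3)] by eventually_elim simp
    have "{z \<in> space (std_normal_vec \<Otimes>\<^sub>M std_normal_vec). mpcn_move \<rho> y (fst z) (snd z) \<noteq> 0 \<and>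
          ln ((norm (mpcn_move \<rho> y (fst z) (snd z)))\<^sup>2) \<in> A} \<in> sets (std_normal_vec \<Otimes>\<^sub>M std_normal_vec)"
      by measurable
    then show "{z. mpcn_move \<rho> y (fst z) (snd z) \<noteq> 0 \<and> ln ((norm (mpcn_move \<rho> y (fst z) (snd z)))\<^sup>2) \<in> A}
        \<in> sets (std_normal_vec \<Otimes>\<^sub>M std_normal_vec)"
      by (simp only: space_pair_measure space_std_normal_vec UNIV_Times_UNIV UNIV_I simp_thms)
    have "{z \<in> space (std_normal_vec \<Otimes>\<^sub>M std_normal_vec).
          ln ((norm (mpcn_move \<rho> y (fst z) (snd z)))\<^sup>2) \<in> A} \<in> sets (std_normal_vec \<Otimes>\<^sub>M std_normal_vec)"
      by measurable
    then show "{z. ln ((norm (mpcn_move \<rho> y (fst z) (snd z)))\<^sup>2) \<in> A}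
        \<in> sets (std_normal_vec \<Otimes>\<^sub>M std_normal_vec)"
      by (simp only: space_pair_measure space_std_normal_vec UNIV_Times_UNIV UNIV_I simp_thms)
  qed
  also have "\<dots> = emeasure (log_norm_increment_law \<rho> y) ((\<lambda>a. a - ?x) ` A)"
    unfolding im log_norm_increment_law_def
    by (subst emeasure_distr) (auto simp: space_pair_measure vimage_def case_prod_beta)
  finally show ?thesis .
qed

text \<open>The total mass is the case \<open>A = UNIV\<close> of the preceding identity, and the
  increment law has mass 1.\<close>

lemma prob_space_mpcn_proposal:
  fixes x :: "real ^ 'n"
  assumes "0 < \<rho>" "\<rho> < 1" "x \<noteq> 0"
  shows "prob_space (mpcn_proposal \<rho> x)"
proof
  interpret \<Gamma>: prob_space "log_norm_increment_law \<rho> x"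
    using symmetric_log_norm_increment_law[of \<rho> x] assms by (simp add: symmetric_about_origin_def)
  have "space (mpcn_proposal \<rho> x) = {z \<in> - {0}. ln ((norm z)\<^sup>2) \<in> UNIV}"
    by (auto simp: mpcn_proposal_def space_restrict_space)
  moreover have "range (\<lambda>a. a - ln ((norm x)\<^sup>2)) = space (log_norm_increment_law \<rho> x)"
    by (simp only: surj_diff_right) (simp add: log_norm_increment_law_def)
  ultimately show "emeasure (mpcn_proposal \<rho> x) (space (mpcn_proposal \<rho> x)) = 1"
    using emeasure_mpcn_proposal_log_norm[OF assms, of UNIV]
    by (simp only: \<Gamma>.emeasure_space_1 sets.top space_borel[symmetric])
qed

text \<open>The mass of \<open>A\<close> is the integral over \<open>z\<close> of an indicator that
  is jointly measurable in \<open>x\<close> and \<open>z\<close>, hence it is measurable in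
  \<open>x\<close>.\<close>

lemma measurable_mpcn_proposal:
  assumes "0 < \<rho>" "\<rho> < 1"
  shows "(mpcn_proposal \<rho> :: real ^ 'n \<Rightarrow> _) \<in> punctured_space \<rightarrow>\<^sub>M prob_algebra punctured_space"
proof (intro measurable_prob_algebraI measurable_subprob_algebra)
  fix x :: "real ^ 'n" assume "x \<in> space punctured_space"
  then show "prob_space (mpcn_proposal \<rho> x)"
    using assms by (simp add: prob_space_mpcn_proposal)
  then show "subprob_space (mpcn_proposal \<rho> x)"
    by (rule prob_space_imp_subprob_space)
  show "sets (mpcn_proposal \<rho> x) = sets punctured_space"
    by (rule sets_mpcn_proposal)
next
  fix A :: "(real ^ 'n) set" assume A: "A \<in> sets punctured_space"
  then have [measurable]: "A \<in> sets borel"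
    by (simp add: sets_punctured_space_iff)
  note [measurable] = measurable_ident_punctured_space
  have "(\<lambda>x. \<integral>\<^sup>+ z. indicator A (mpcn_move \<rho> x (fst z) (snd z))
      \<partial>(std_normal_vec \<Otimes>\<^sub>M std_normal_vec)) \<in> borel_measurable punctured_space"
    by measurable
  moreover have "emeasure (mpcn_proposal \<rho> x) A
    = (\<integral>\<^sup>+ z. indicator A (mpcn_move \<rho> x (fst z) (snd z)) \<partial>(std_normal_vec \<Otimes>\<^sub>M std_normal_vec))" for x
  proof -
    let ?B = "{z. mpcn_move \<rho> x (fst z) (snd z) \<in> A}"
    have "?B \<in> sets (std_normal_vec \<Otimes>\<^sub>M std_normal_vec)"
      using measurable_sets[of "\<lambda>z. mpcn_move \<rho> x (fst z) (snd z)"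
          "std_normal_vec \<Otimes>\<^sub>M std_normal_vec" borel A]
      by (simp add: vimage_def space_pair_measure)
    then show ?thesis
      using A by (simp add: emeasure_mpcn_proposal nn_integral_indicator[symmetric] indicator_def
          del: nn_integral_indicator)
  qed
  ultimately show "(\<lambda>x. emeasure (mpcn_proposal \<rho> x) A) \<in> borel_measurable punctured_space"
    by simp
qed

section \<open>The acceptance probability and the random-walk Metropolis property\<close>

lemma borel_measurable_mpcn_acceptance:
  assumes [measurable]: "\<pi> \<in> borel_measurable borel"
  shows "case_prod (mpcn_acceptance \<pi>) \<in> borel_measurable (punctured_space \<Otimes>\<^sub>M punctured_space)"
proof -
  note [measurable] = measurable_ident_punctured_space
  have [measurable]: "\<pi> \<in> borel_measurable punctured_space"
    using measurable_compose[OF measurable_ident_punctured_space assms] .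
  show ?thesis
    unfolding mpcn_acceptance_def by measurable
qed

theorem proposition2p1:
  fixes \<rho> :: real
  assumes "CARD('n::finite) \<ge> 2" and "0 < \<rho>" and "\<rho> < 1"
  shows "(\<forall>x :: real ^ 'n. x \<noteq> 0 \<longrightarrow> symmetric_about_origin (log_norm_increment_law \<rho> x)) \<and>
         (\<forall>(x :: real ^ 'n) (y :: real ^ 'n). x \<noteq> 0 \<longrightarrow> y \<noteq> 0 \<longrightarrow>
            log_norm_increment_law \<rho> x = log_norm_increment_law \<rho> y) \<and>
         (\<forall>\<pi> :: real ^ 'n \<Rightarrow> real. target_density \<pi> \<longrightarrow>
            random_walk_metropolis_property punctured_space (mpcn_proposal \<rho>) (mpcn_kernel \<rho> \<pi>)
              (\<lambda>x. ln ((norm x)\<^sup>2)))"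
proof (intro conjI allI impI)
  show sym: "symmetric_about_origin (log_norm_increment_law \<rho> x)" if "x \<noteq> 0" for x :: "real ^ 'n"
    using assms that by (intro symmetric_log_norm_increment_law) auto
  show unique: "log_norm_increment_law \<rho> x = log_norm_increment_law \<rho> y"
    if "x \<noteq> 0" "y \<noteq> 0" for x y :: "real ^ 'n"
    using assms that by (intro log_norm_increment_law_unique) auto
  fix \<pi> :: "real ^ 'n \<Rightarrow> real"
  assume \<pi>: "target_density \<pi>"
  \<comment> \<open>The increment law at any nonzero reference point \<open>e\<close> can serve as
    \<Gamma>, since by \<open>unique\<close> it is the same at every nonzero point.\<close>
  obtain e :: "real ^ 'n" where e: "e \<noteq> 0"
    by (meson one_neq_zero)
  have "random_walk_property punctured_space (mpcn_proposal \<rho>) (\<lambda>x :: real ^ 'n. ln ((norm x)\<^sup>2))"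
    unfolding random_walk_property_def
  proof (intro conjI exI[of _ "log_norm_increment_law \<rho> e"] allI ballI impI)
    show "mpcn_proposal \<rho> \<in> (punctured_space :: (real ^ 'n) measure) \<rightarrow>\<^sub>M prob_algebra punctured_space"
      using assms by (intro measurable_mpcn_proposal)
    show "(\<lambda>x :: real ^ 'n. ln ((norm x)\<^sup>2)) \<in> borel_measurable punctured_space"
      using measurable_ident_punctured_space by measurable
    show "symmetric_about_origin (log_norm_increment_law \<rho> e)"
      using e by (rule sym)
  next
    fix x and y :: "real ^ 'n" and A :: "real set"
    assume "y \<in> space punctured_space" "ln ((norm y)\<^sup>2) = x" "A \<in> sets borel"
    then show "emeasure (mpcn_proposal \<rho> y) {z \<in> space punctured_space. ln ((norm z)\<^sup>2) \<in> A}
        = emeasure (log_norm_increment_law \<rho> e) ((\<lambda>a. a - x) ` A)"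
      using assms emeasure_mpcn_proposal_log_norm[of \<rho> y A] unique[OF e, of y] by auto
  qed
  moreover have "case_prod (mpcn_acceptance \<pi>) \<in> borel_measurable (punctured_space \<Otimes>\<^sub>M punctured_space)"
    using \<pi> by (intro borel_measurable_mpcn_acceptance) (simp add: target_density_def)
  moreover have "0 \<le> mpcn_acceptance \<pi> x y" "mpcn_acceptance \<pi> x y \<le> 1" for x y
    using \<pi> by (auto simp: mpcn_acceptance_def target_density_def)
  \<comment> \<open>The witness for \<alpha> is \<open>mpcn_acceptance \<pi>\<close>, from which
    \<open>mpcn_kernel\<close> is built by definition.\<close>
  ultimately show "random_walk_metropolis_property punctured_space (mpcn_proposal \<rho>)
      (mpcn_kernel \<rho> \<pi>) (\<lambda>x. ln ((norm x)\<^sup>2))"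
    unfolding random_walk_metropolis_property_def mpcn_kernel_def by blast
qed

end
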